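(* Let $c_0,\Gamma,\alpha,b,c_1,c_2\in\mathbb R$ with $b\neq -1$, and let $T>0$. Then the generalized $b$-equation $$u_t-\alpha^2u_{txx}+c_0u_x+(b+1)uu_x+\Gamma u_{xxx}=\alpha^2\big(c_1u_xu_{xx}+c_2uu_{xxx}\big)$$ admits the explicit self-similar blowup solution $$u(t,x)=-\frac{1}{b+1}\Big(\frac{x}{T-t}+c_0\Big),\qquad 0<t<T,\ x\in\mathbb R .$$
   Context: Here $T$ is the blowup time, an arbitrary positive constant. "Blowup" refers to the fact that $|\partial_x u(t,x)|_{x=0}|\to\infty$ as $t\to T^-$. "Self-similar" refers to the dependence on $x$ and $t$ through the similarity variable $x/(T-t)$. *)

theory Defs
  imports "HOL-Analysis.Analysis"
begin

text \<open>Functions of time and space are curried, \<open>u t x\<close>, and only their values on the open strip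
  \<open>0 < t < T\<close> are meaningful: every notion below depends on nothing else.\<close>

definition strip :: "real \<Rightarrow> (real \<times> real) set" where
  "strip T = {0<..<T} \<times> UNIV"

definition partial_t :: "(real \<Rightarrow> real \<Rightarrow> real) \<Rightarrow> real \<Rightarrow> real \<Rightarrow> real" where
  "partial_t u t x = deriv (\<lambda>s. u s x) t"

definition partial_x :: "(real \<Rightarrow> real \<Rightarrow> real) \<Rightarrow> real \<Rightarrow> real \<Rightarrow> real" where
  "partial_x u t x = deriv (\<lambda>y. u t y) x"

text \<open>Class \<open>C\<^sup>k\<close> on the strip: all partial derivatives up to order \<open>k\<close>, in any order of
  differentiation, exist and are jointly continuous. Existence is demanded explicitly because
  \<^const>\<open>deriv\<close> is total.\<close>

primrec Ck_on_strip :: "real \<Rightarrow> nat \<Rightarrow> (real \<Rightarrow> real \<Rightarrow> real) \<Rightarrow> bool" where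
  "Ck_on_strip T 0 u \<longleftrightarrow> continuous_on (strip T) (\<lambda>(t, x). u t x)"
| "Ck_on_strip T (Suc k) u \<longleftrightarrow>
     continuous_on (strip T) (\<lambda>(t, x). u t x) \<and>
     (\<forall>(t, x) \<in> strip T. (\<lambda>s. u s x) field_differentiable at t) \<and>
     (\<forall>(t, x) \<in> strip T. (\<lambda>y. u t y) field_differentiable at x) \<and>
     Ck_on_strip T k (partial_t u) \<and>
     Ck_on_strip T k (partial_x u)"

definition satisfies_gen_b_equation ::
    "real \<Rightarrow> real \<Rightarrow> real \<Rightarrow> real \<Rightarrow> real \<Rightarrow> real \<Rightarrow> (real \<Rightarrow> real \<Rightarrow> real) \<Rightarrow> real \<Rightarrow> real \<Rightarrow> bool" where
  "satisfies_gen_b_equation c0 \<Gamma> \<alpha> b c1 c2 u t x \<longleftrightarrow>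
     (let u_t = partial_t u; u_x = partial_x u; u_xx = partial_x u_x; u_xxx = partial_x u_xx;
          u_txx = partial_x (partial_x u_t)
      in u_t t x - \<alpha>\<^sup>2 * u_txx t x + c0 * u_x t x + (b + 1) * u t x * u_x t x + \<Gamma> * u_xxx t x
         = \<alpha>\<^sup>2 * (c1 * u_x t x * u_xx t x + c2 * u t x * u_xxx t x))"

text \<open>A classical solution: the equation is of third order, so \<open>u\<close> is required to be \<open>C\<^sup>3\<close>.\<close>

definition gen_b_equation_solution ::
    "real \<Rightarrow> real \<Rightarrow> real \<Rightarrow> real \<Rightarrow> real \<Rightarrow> real \<Rightarrow> real \<Rightarrow> (real \<Rightarrow> real \<Rightarrow> real) \<Rightarrow> bool" where
  "gen_b_equation_solution c0 \<Gamma> \<alpha> b c1 c2 T u \<longleftrightarrow>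
     Ck_on_strip T 3 u \<and>
     (\<forall>(t, x) \<in> strip T. satisfies_gen_b_equation c0 \<Gamma> \<alpha> b c1 c2 u t x)"

definition self_similar :: "real \<Rightarrow> (real \<Rightarrow> real \<Rightarrow> real) \<Rightarrow> bool" where
  "self_similar T u \<longleftrightarrow> (\<exists>U :: real \<Rightarrow> real. \<forall>(t, x) \<in> strip T. u t x = U (x / (T - t)))"

definition blows_up :: "real \<Rightarrow> (real \<Rightarrow> real \<Rightarrow> real) \<Rightarrow> bool" where
  "blows_up T u \<longleftrightarrow> filterlim (\<lambda>t. \<bar>partial_x u t 0\<bar>) at_top (at_left T)"

end

theory Submission imports Defs
begin

text \<open>With \<open>A = - 1 / (b + 1)\<close> the function is \<open>u = A * (x / (T - t) + c0)\<close>, which is affine in \<open>x\<close>.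
  Hence \<open>u_xx\<close>, \<open>u_xxx\<close> and \<open>u_txx\<close> vanish, so \<open>\<alpha>\<close>, \<open>\<Gamma>\<close>, \<open>c1\<close> and \<open>c2\<close> drop out and only the
  Burgers-type equation \<open>u_t + (c0 + (b + 1) * u) * u_x = 0\<close> is left. The shift by \<open>c0\<close> makes the
  transport speed \<open>c0 + (b + 1) * u\<close> equal to \<open>- x / (T - t)\<close>, and the equation reduces to the
  cancellation of \<open>u_t = A * x / (T - t)\<^sup>2\<close> against \<open>- x / (T - t) * (A / (T - t))\<close>. The slope
  \<open>u_x = A / (T - t)\<close> is unbounded as \<open>t\<close> tends to \<open>T\<close> from the left.

  For the regularity, \<open>u\<close> is placed in the family \<open>(p * x + q) / (T - t) ^ n + r\<close>, which is stable
  under both partial derivatives (\<open>affine_profile_partial_t\<close>, \<open>affine_profile_partial_x\<close>). Induction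
  on the order then gives every \<open>C\<^sup>k\<close> (\<open>affine_profile_Ck\<close>), and the derivatives in the equation are
  read off by following the parameters.\<close>

text \<open>The predicate fixes the values on the strip alone. Nothing is known about \<open>u\<close> elsewhere,
  so equality of functions would be too strong. The summand \<open>r\<close> is there for the constant \<open>A * c0\<close>,
  which is not of the form \<open>(p * x + q) / (T - t) ^ n\<close> with the exponent \<open>n = 1\<close> of the rest.\<close>

definition affine_profile ::
    "real \<Rightarrow> real \<Rightarrow> real \<Rightarrow> real \<Rightarrow> nat \<Rightarrow> (real \<Rightarrow> real \<Rightarrow> real) \<Rightarrow> bool" where
  "affine_profile T p q r n u \<longleftrightarrow>
     (\<forall>t x. 0 < t \<longrightarrow> t < T \<longrightarrow> u t x = (p * x + q) / (T - t) ^ n + r)"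

lemma affine_profileD:
  "affine_profile T p q r n u \<Longrightarrow> 0 < t \<Longrightarrow> t < T \<Longrightarrow> u t x = (p * x + q) / (T - t) ^ n + r"
  by (simp add: affine_profile_def)

text \<open>The interval \<open>{0<..<T}\<close> is open, so the values of \<open>u\<close> on the strip determine its time derivative.\<close>

lemma affine_profile_has_derivative_t:
  assumes "affine_profile T p q r n u" "0 < t" "t < T"
  shows "((\<lambda>s. u s x) has_field_derivative
           (real n * p * x + real n * q) / (T - t) ^ Suc n) (at t)"
proof (rule has_field_derivative_transform_within_open)
  \<comment> \<open>The power rule for \<open>inverse (T - s)\<close> covers \<open>n = 0\<close> as well: the exponent \<open>n - Suc 0\<close>
     is truncated there, but the factor \<open>real n\<close> is zero.\<close>
  have "((\<lambda>s. inverse (T - s)) has_field_derivative inverse (T - t) ^ 2) (at t)"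
    using assms(3) by (auto intro!: derivative_eq_intros simp: power2_eq_square)
  then have "((\<lambda>s. inverse (T - s) ^ n) has_field_derivative
               real n * (inverse (T - t) ^ 2 * inverse (T - t) ^ (n - Suc 0))) (at t)"
    by (rule DERIV_power)
  moreover have "real n * (inverse (T - t) ^ 2 * inverse (T - t) ^ (n - Suc 0))
      = real n * inverse (T - t) ^ Suc n"
    by (cases n) (simp_all add: power2_eq_square mult.assoc)
  ultimately have "((\<lambda>s. inverse (T - s) ^ n) has_field_derivative
               real n * inverse (T - t) ^ Suc n) (at t)"
    by simp
  from DERIV_add[OF DERIV_cmult[OF this, of "p * x + q"] DERIV_const[of r]]
  have "((\<lambda>s. (p * x + q) * inverse (T - s) ^ n + r) has_field_derivative
          (p * x + q) * (real n * inverse (T - t) ^ Suc n)) (at t)"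
    by (simp only: add_0_right)
  moreover have "(p * x + q) * (real n * inverse (T - t) ^ Suc n)
      = (real n * p * x + real n * q) / (T - t) ^ Suc n"
    by (simp add: divide_inverse power_inverse algebra_simps del: power_Suc)
  ultimately show "((\<lambda>s. (p * x + q) / (T - s) ^ n + r) has_field_derivative
           (real n * p * x + real n * q) / (T - t) ^ Suc n) (at t)"
    by (simp only: divide_inverse power_inverse)
  show "open {0<..<T}" "t \<in> {0<..<T}"
    using assms by auto
  show "(p * x + q) / (T - s) ^ n + r = u s x" if "s \<in> {0<..<T}" for s
    using affine_profileD[OF assms(1)] that by simp
qed

lemma affine_profile_has_derivative_x:
  assumes "affine_profile T p q r n u" "0 < t" "t < T"
  shows "((\<lambda>y. u t y) has_field_derivative p / (T - t) ^ n) (at x)"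
proof -
  have "(\<lambda>y. u t y) = (\<lambda>y. (p * y + q) / (T - t) ^ n + r)"
    using affine_profileD[OF assms] by blast
  then show ?thesis
    using assms(3) by (auto intro!: derivative_eq_intros)
qed

lemma affine_profile_partial_t:
  assumes "affine_profile T p q r n u"
  shows "affine_profile T (real n * p) (real n * q) 0 (Suc n) (partial_t u)"
  unfolding affine_profile_def partial_t_def
  using DERIV_imp_deriv[OF affine_profile_has_derivative_t[OF assms]] by simp

lemma affine_profile_partial_x:
  assumes "affine_profile T p q r n u"
  shows "affine_profile T 0 p 0 n (partial_x u)"
  unfolding affine_profile_def partial_x_def
  using DERIV_imp_deriv[OF affine_profile_has_derivative_x[OF assms]] by simp

lemma affine_profile_continuous_on:
  assumes "affine_profile T p q r n u"
  shows "continuous_on (strip T) (\<lambda>(t, x). u t x)"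
proof -
  have "continuous_on (strip T) (\<lambda>z. (p * snd z + q) / (T - fst z) ^ n + r)"
    by (auto intro!: continuous_intros simp: strip_def)
  moreover have "(p * snd z + q) / (T - fst z) ^ n + r = (\<lambda>(t, x). u t x) z" if "z \<in> strip T" for z
    using affine_profileD[OF assms] that by (auto simp: strip_def)
  ultimately show ?thesis
    by (rule continuous_on_eq)
qed

text \<open>Both derivatives of a member are again members, with other parameters, so the recursion that
  defines \<open>C\<^sup>k\<close> never leaves the family.\<close>

lemma affine_profile_Ck:
  assumes "affine_profile T p q r n u"
  shows "Ck_on_strip T k u"
  using assms
proof (induction k arbitrary: p q r n u)
  case 0
  then show ?case
    by (simp add: affine_profile_continuous_on)
next
  case (Suc k)
  have "(\<lambda>s. u s x) field_differentiable at t" "(\<lambda>y. u t y) field_differentiable at x"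
    if "(t, x) \<in> strip T" for t x
    using that by (auto simp: field_differentiable_def strip_def
        intro: affine_profile_has_derivative_t[OF Suc.prems]
          affine_profile_has_derivative_x[OF Suc.prems])
  moreover have "Ck_on_strip T k (partial_t u)" "Ck_on_strip T k (partial_x u)"
    using Suc.IH affine_profile_partial_t[OF Suc.prems] affine_profile_partial_x[OF Suc.prems]
    by blast+
  ultimately show ?case
    using affine_profile_continuous_on[OF Suc.prems] by auto
qed

text \<open>For \<open>u = p * x / (T - t) + r\<close> the left side minus the right side of the equation is
  \<open>p * (c0 + (b + 1) * r) / (T - t) + p * (1 + (b + 1) * p) * x / (T - t)\<^sup>2\<close>. The conditions on \<open>p\<close>
  and \<open>r\<close> say that both coefficients vanish without \<open>u\<close> being constant.\<close>

lemma affine_profile_satisfies_gen_b_equation: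
  assumes u: "affine_profile T p 0 r 1 u"
    and p: "(b + 1) * p = -1" and r: "(b + 1) * r = - c0"
    and t: "0 < t" "t < T"
  shows "satisfies_gen_b_equation c0 \<Gamma> \<alpha> b c1 c2 u t x"
proof -
  note u_t = affine_profile_partial_t[OF u]
  note u_x = affine_profile_partial_x[OF u]
  note u_xx = affine_profile_partial_x[OF u_x]
  note u_xxx = affine_profile_partial_x[OF u_xx]
  note u_txx = affine_profile_partial_x[OF affine_profile_partial_x[OF u_t]]
  have speed: "c0 + (b + 1) * u t x = - x / (T - t)"
  proof -
    have "c0 + (b + 1) * u t x = (c0 + (b + 1) * r) + ((b + 1) * p) * x / (T - t)"
      using affine_profileD[OF u t] by (simp add: distrib_left)
    then show ?thesis
      unfolding p r by simp
  qed
  have "partial_t u t x + c0 * partial_x u t x + (b + 1) * u t x * partial_x u t x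
      = partial_t u t x + (c0 + (b + 1) * u t x) * partial_x u t x"
    by (simp add: distrib_right)
  also have "\<dots> = 0"
    unfolding speed affine_profileD[OF u_t t] affine_profileD[OF u_x t]
    by simp
  finally show ?thesis
    unfolding satisfies_gen_b_equation_def Let_def
      affine_profileD[OF u_xx t] affine_profileD[OF u_xxx t] affine_profileD[OF u_txx t]
    by simp
qed

lemma affine_profile_blows_up:
  assumes u: "affine_profile T p q r 1 u" and "p \<noteq> 0" and "T > 0"
  shows "blows_up T u"
proof -
  have "filterlim (\<lambda>t. T - t) (at_right 0) (at_left T)"
    unfolding filterlim_at
    by (auto intro!: tendsto_eq_intros simp: eventually_at_filter)
  then have "filterlim (\<lambda>t. inverse (T - t)) at_top (at_left T)"
    by (rule filterlim_compose[OF filterlim_inverse_at_top_right])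
  then have "filterlim (\<lambda>t. \<bar>p\<bar> * inverse (T - t)) at_top (at_left T)"
    by (rule filterlim_tendsto_pos_mult_at_top[OF tendsto_const, rotated]) (use \<open>p \<noteq> 0\<close> in simp)
  moreover have "\<forall>\<^sub>F t in at_left T. \<bar>p\<bar> * inverse (T - t) = \<bar>partial_x u t 0\<bar>"
  proof (rule eventually_at_leftI[OF _ \<open>T > 0\<close>])
    fix t assume "t \<in> {0<..<T}"
    then show "\<bar>p\<bar> * inverse (T - t) = \<bar>partial_x u t 0\<bar>"
      using affine_profileD[OF affine_profile_partial_x[OF u]]
      by (simp add: divide_inverse abs_mult)
  qed
  ultimately show ?thesis
    unfolding blows_up_def by (rule filterlim_cong[THEN iffD1, OF refl refl, rotated])
qed

theorem theorem1p1:
  fixes c0 \<Gamma> \<alpha> b c1 c2 T :: real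
    and u :: "real \<Rightarrow> real \<Rightarrow> real"
  assumes "b \<noteq> -1"
    and "T > 0"
    and "\<And>t x. 0 < t \<Longrightarrow> t < T \<Longrightarrow> u t x = - (1 / (b + 1)) * (x / (T - t) + c0)"
  shows "gen_b_equation_solution c0 \<Gamma> \<alpha> b c1 c2 T u \<and> self_similar T u \<and> blows_up T u"
proof -
  define A where "A = - (1 / (b + 1))"
  have "b + 1 \<noteq> 0"
    using assms(1) by linarith
  then have A: "(b + 1) * A = -1" "A \<noteq> 0"
    by (simp_all add: A_def)
  have u: "u t x = A * (x / (T - t) + c0)" if "0 < t" "t < T" for t x
    using assms(3)[OF that] by (simp add: A_def)
  then have profile: "affine_profile T A 0 (A * c0) 1 u"
    by (simp add: affine_profile_def distrib_left)
  have "(b + 1) * (A * c0) = - c0"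
    using A(1) by (simp flip: mult.assoc)
  then have "satisfies_gen_b_equation c0 \<Gamma> \<alpha> b c1 c2 u t x" if "0 < t" "t < T" for t x
    using affine_profile_satisfies_gen_b_equation[OF profile A(1)] that by blast
  then have "gen_b_equation_solution c0 \<Gamma> \<alpha> b c1 c2 T u"
    using affine_profile_Ck[OF profile]
    unfolding gen_b_equation_solution_def by (auto simp: strip_def)
  moreover have "self_similar T u"
    unfolding self_similar_def
    by (rule exI[of _ "\<lambda>\<xi>. A * (\<xi> + c0)"]) (use u in \<open>auto simp: strip_def\<close>)
  moreover have "blows_up T u"
    using affine_profile_blows_up[OF profile A(2) assms(2)] .
  ultimately show ?thesis
    by blast
qed

end
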